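(* Let $G=\langle V,E\rangle$ be an infinite, connected, simple graph, regular of finite degree $\delta$, with root $o\in V$, and let $\Gamma$ be a transitive unimodular subgroup of the automorphism group of $G$. Let $\mu$ be a $\Gamma$-invariant probability measure on $\Omega=2^E$ (invariant bond percolation), with $\mathcal C_o$ the connected component of $o$ in the random partial graph $H(\omega)$, and suppose that the cluster size has distribution $$\mu[|\mathcal C_o|=m]=C\,e^{-m/\widehat N},\qquad m\in\{1,2,3,\dots\},$$ for some positive integer $\widehat N$ and normalising constant $C$. Put $$\nu=\frac1{(\delta-1)\ln16},\quad r=\frac{\nu}{1+\nu},\quad a=1+\frac{\sqrt{\pi\delta}}{2^{1-\nu}},\quad c=a\Big(1+e\cdot\big(1+(\widehat N+1)^{\frac1{1+2\nu}}\big)\Big),\quad \rho=4^{\frac{(1+\nu)^2}{2\nu}} .$$ Then for all $t\ge\frac{\delta}{4\widehat N}$, the time-continuous regularised random walk $\widehat X_t$ satisfies $$\mathbb E_\mu\,\mathbb P^o[\widehat X_t=o]\;\le\;\mathbb E_\mu\Big[\frac1{|\mathcal C_o|}\Big]+c\,t^{-\frac16(1+r)}\exp\Big\{-\Big(\frac{4t}{\delta\widehat N^2}\Big)^{\frac13}\Big\}+\sqrt\rho\;t^{\frac14}e^{-\frac{4\sqrt t}{\delta\rho}}+e^{-\frac{t}{16\widehat N}} .$$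
   Context: For $\omega\in2^E$, $H(\omega)$ is the partial graph of $G$ with vertex set $V$ and edge set given by $\omega$. $\Omega=2^E$ carries the product $\sigma$-algebra, and $\mathbb E_\mu$ is expectation with respect to $\mu$. A subgroup $\Gamma$ of the automorphism group acting transitively on $V$ is unimodular if $|\Gamma_x y|=|\Gamma_y x|$ for all $x,y\in V$, where $\Gamma_x$ is the stabiliser of $x$ in $\Gamma$ and $\Gamma_xy$ is the orbit of $y$ under it. The regularised random walk (RRW) on $H(\omega)$ has transition matrix $A$ with $A_{vw}=1/\delta$ if $\{v,w\}$ is an edge of $H(\omega)$, $A_{vv}=(\delta-\deg_{H(\omega)}(v))/\delta$, and $A_{vw}=0$ otherwise (i.e. it is the simple random walk on $H(\omega)$ decorated with loops, each counting one towards the degree, so that every vertex has degree $\delta$). The time-continuous RRW started at $o$ has $\mathbb P^o[\widehat X_t=o]=\big(e^{-t(I-A)}\big)_{oo}$, with $A$ restricted to the finite cluster $\mathcal C_o$. *)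

theory Defs
  imports "HOL-Probability.Probability" "HOL-Algebra.Group_Action"
begin

section \<open>Graphs\<close>

text \<open>
  Undirected edges are two-element sets of vertices. Since an infinite set has cardinality 0,
  finiteness of the neighbourhoods is demanded separately in \<open>regular_graph\<close>.
\<close>

definition simple_graph :: "'v set \<Rightarrow> 'v set set \<Rightarrow> bool" where
  "simple_graph V E \<longleftrightarrow> (\<forall>e\<in>E. e \<subseteq> V \<and> card e = 2)"

definition nbrs :: "'v set set \<Rightarrow> 'v \<Rightarrow> 'v set" where
  "nbrs E v = {w. {v, w} \<in> E}"

definition regular_graph :: "'v set \<Rightarrow> 'v set set \<Rightarrow> nat \<Rightarrow> bool" where
  "regular_graph V E \<delta> \<longleftrightarrow> (\<forall>v\<in>V. finite (nbrs E v) \<and> card (nbrs E v) = \<delta>)"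

definition component :: "'v set set \<Rightarrow> 'v \<Rightarrow> 'v set" where
  "component E v = {w. (v, w) \<in> {(x, y). {x, y} \<in> E}\<^sup>*}"

definition connected_graph :: "'v set \<Rightarrow> 'v set set \<Rightarrow> bool" where
  "connected_graph V E \<longleftrightarrow> (\<forall>v\<in>V. component E v = V)"


section \<open>Automorphisms\<close>

text \<open>
  As in \<open>BijGroup\<close>, automorphisms are extensional functions on the vertex set, so that they are
  determined by their values there.
\<close>

definition graph_auts :: "'v set \<Rightarrow> 'v set set \<Rightarrow> ('v \<Rightarrow> 'v) set" where
  "graph_auts V E = {\<gamma> \<in> Bij V. \<forall>u\<in>V. \<forall>v\<in>V. {\<gamma> u, \<gamma> v} \<in> E \<longleftrightarrow> {u, v} \<in> E}"

definition graph_aut_group :: "'v set \<Rightarrow> 'v set set \<Rightarrow> ('v \<Rightarrow> 'v) monoid" where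
  "graph_aut_group V E = BijGroup V \<lparr>carrier := graph_auts V E\<rparr>"

lemma group_graph_aut_group: "group (graph_aut_group V E)"
proof -
  interpret B: group "BijGroup V" by (rule group_BijGroup)
  have "subgroup (graph_auts V E) (BijGroup V)"
  proof (rule B.subgroupI)
    show "graph_auts V E \<subseteq> carrier (BijGroup V)"
      by (auto simp: graph_auts_def BijGroup_def)
    have "(\<lambda>x\<in>V. x) \<in> graph_auts V E"
      by (auto simp: graph_auts_def id_Bij)
    then show "graph_auts V E \<noteq> {}" by blast
  next
    fix f assume f: "f \<in> graph_auts V E"
    then have fB: "f \<in> Bij V" by (simp add: graph_auts_def)
    have bij: "bij_betw f V V" using fB by (simp add: Bij_def)
    have "(\<lambda>x\<in>V. inv_into V f x) \<in> graph_auts V E"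
      unfolding graph_auts_def
    proof (intro CollectI conjI ballI)
      show "(\<lambda>x\<in>V. inv_into V f x) \<in> Bij V" by (rule restrict_inv_into_Bij[OF fB])
      fix u v assume uv: "u \<in> V" "v \<in> V"
      have iv: "inv_into V f u \<in> V" "inv_into V f v \<in> V"
        using uv bij by (metis bij_betw_def inv_into_into)+
      have "f (inv_into V f u) = u" "f (inv_into V f v) = v"
        using uv bij by (auto simp: bij_betw_inv_into_right)
      then show "{(\<lambda>x\<in>V. inv_into V f x) u, (\<lambda>x\<in>V. inv_into V f x) v} \<in> E \<longleftrightarrow> {u, v} \<in> E"
        using f iv uv unfolding graph_auts_def by simp metis
    qed
    then show "inv\<^bsub>BijGroup V\<^esub> f \<in> graph_auts V E"
      by (simp add: inv_BijGroup[OF fB])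
  next
    fix f g assume f: "f \<in> graph_auts V E" and g: "g \<in> graph_auts V E"
    have fg: "f \<in> Bij V" "g \<in> Bij V" using f g by (auto simp: graph_auts_def)
    have gV: "g x \<in> V" if "x \<in> V" for x
      using fg(2) that Bij_imp_funcset by blast
    have "compose V f g \<in> graph_auts V E"
      using f g gV unfolding graph_auts_def
      by (auto simp: compose_Bij compose_eq)
    then show "f \<otimes>\<^bsub>BijGroup V\<^esub> g \<in> graph_auts V E"
      using fg by (simp add: BijGroup_def)
  qed
  then show ?thesis
    unfolding graph_aut_group_def by (rule B.subgroup_imp_group)
qed

abbreviation vstab :: "('v \<Rightarrow> 'v) monoid \<Rightarrow> 'v \<Rightarrow> ('v \<Rightarrow> 'v) set" where
  "vstab G x \<equiv> stabilizer G (\<lambda>\<gamma>. \<gamma>) x"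

definition transitive_on_vertices :: "'v set \<Rightarrow> 'v set set \<Rightarrow> ('v \<Rightarrow> 'v) set \<Rightarrow> bool" where
  "transitive_on_vertices V E \<Gamma> \<longleftrightarrow>
    (\<forall>x\<in>V. orbit (graph_aut_group V E \<lparr>carrier := \<Gamma>\<rparr>) (\<lambda>\<gamma>. \<gamma>) x = V)"

definition unimodular :: "'v set \<Rightarrow> 'v set set \<Rightarrow> ('v \<Rightarrow> 'v) set \<Rightarrow> bool" where
  "unimodular V E \<Gamma> \<longleftrightarrow>
    (let G = graph_aut_group V E \<lparr>carrier := \<Gamma>\<rparr> in
      \<forall>x\<in>V. \<forall>y\<in>V.
        card (orbit (G \<lparr>carrier := vstab G x\<rparr>) (\<lambda>\<gamma>. \<gamma>) y) =
        card (orbit (G \<lparr>carrier := vstab G y\<rparr>) (\<lambda>\<gamma>. \<gamma>) x))"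


section \<open>Bond percolation\<close>

definition config_space :: "'v set set \<Rightarrow> ('v set \<Rightarrow> bool) measure" where
  "config_space E = (\<Pi>\<^sub>M e\<in>E. count_space UNIV)"

text \<open>
  The edge set of the random partial graph. Configurations are arbitrary (namely
  \<open>undefined\<close>) outside \<open>E\<close>, hence the restriction to \<open>E\<close>.
\<close>

definition open_edges :: "'v set set \<Rightarrow> ('v set \<Rightarrow> bool) \<Rightarrow> 'v set set" where
  "open_edges E \<omega> = {e\<in>E. \<omega> e}"

definition cluster :: "'v set set \<Rightarrow> ('v set \<Rightarrow> bool) \<Rightarrow> 'v \<Rightarrow> 'v set" where
  "cluster E \<omega> v = component (open_edges E \<omega>) v"

text \<open>
  The pullback of a configuration along \<open>\<gamma>\<close> is its translate by the inverse of \<open>\<gamma>\<close>; for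
  invariance under all elements of a group this makes no difference.
\<close>

definition pullback_config ::
    "'v set set \<Rightarrow> ('v \<Rightarrow> 'v) \<Rightarrow> ('v set \<Rightarrow> bool) \<Rightarrow> ('v set \<Rightarrow> bool)" where
  "pullback_config E \<gamma> \<omega> = (\<lambda>e\<in>E. \<omega> (\<gamma> ` e))"

definition invariant_percolation ::
    "'v set set \<Rightarrow> ('v \<Rightarrow> 'v) set \<Rightarrow> ('v set \<Rightarrow> bool) measure \<Rightarrow> bool" where
  "invariant_percolation E \<Gamma> \<mu> \<longleftrightarrow>
    prob_space \<mu> \<and> sets \<mu> = sets (config_space E) \<and>
    (\<forall>\<gamma>\<in>\<Gamma>. distr \<mu> (config_space E) (pullback_config E \<gamma>) = \<mu>)"

lemma measurable_pullback_config:
  assumes "simple_graph V E" and "\<gamma> \<in> graph_auts V E"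
  shows "pullback_config E \<gamma> \<in> config_space E \<rightarrow>\<^sub>M config_space E"
proof -
  have "\<gamma> ` e \<in> E" if e: "e \<in> E" for e
  proof -
    obtain u v where "e = {u, v}" "u \<in> V" "v \<in> V"
      using assms(1) e unfolding simple_graph_def by (metis card_2_iff insert_subset)
    then show ?thesis using assms(2) e by (simp add: graph_auts_def)
  qed
  then show ?thesis
    unfolding pullback_config_def config_space_def
    by (intro measurable_restrict measurable_component_singleton) auto
qed


section \<open>The regularised random walk\<close>

text \<open>
  Matrices are indexed by vertices; products, powers and exponentials are those of the submatrix
  indexed by a finite vertex set \<open>S\<close>.
\<close>

primrec mat_pow :: "'v set \<Rightarrow> ('v \<Rightarrow> 'v \<Rightarrow> real) \<Rightarrow> nat \<Rightarrow> 'v \<Rightarrow> 'v \<Rightarrow> real" where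
  "mat_pow S M 0 v w = (if v = w then 1 else 0)"
| "mat_pow S M (Suc k) v w = (\<Sum>u\<in>S. M v u * mat_pow S M k u w)"

definition mat_exp :: "'v set \<Rightarrow> ('v \<Rightarrow> 'v \<Rightarrow> real) \<Rightarrow> 'v \<Rightarrow> 'v \<Rightarrow> real" where
  "mat_exp S M v w = (\<Sum>k. mat_pow S M k v w / fact k)"

text \<open>The argument \<open>H\<close> is the edge set of a partial graph of the \<open>\<delta>\<close>-regular graph.\<close>

definition rrw_matrix :: "nat \<Rightarrow> 'v set set \<Rightarrow> 'v \<Rightarrow> 'v \<Rightarrow> real" where
  "rrw_matrix \<delta> H v w =
    (if {v, w} \<in> H then 1 / real \<delta>
     else if v = w then (real \<delta> - real (card (nbrs H v))) / real \<delta>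
     else 0)"

text \<open>
  The probability that the time-continuous walk on \<open>H(\<omega>)\<close> started at \<open>v\<close> is at \<open>v\<close> at time \<open>t\<close>.
  It is only meaningful if the cluster of \<open>v\<close> is finite.
\<close>

definition rrw_return_prob :: "nat \<Rightarrow> 'v set set \<Rightarrow> ('v set \<Rightarrow> bool) \<Rightarrow> real \<Rightarrow> 'v \<Rightarrow> real" where
  "rrw_return_prob \<delta> E \<omega> t v =
    mat_exp (cluster E \<omega> v)
      (\<lambda>x y. - t * ((if x = y then 1 else 0) - rrw_matrix \<delta> (open_edges E \<omega>) x y)) v v"

end

theory Submission
  imports Defs "HOL-Library.Transitive_Closure_Table"
begin

text \<open>
  On a cluster with \<open>m\<close> vertices the regularised walk has spectral gap at least
  \<open>4 / (\<delta> m\<^sup>2)\<close>: a function with zero sum and oscillation \<open>D\<close> has square norm at most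
  \<open>m D\<^sup>2 / 4\<close>, and \<open>D\<^sup>2\<close> is at most \<open>m\<close> times the Dirichlet energy along a simple path.
  Hence the return probability is at most \<open>1 / m + exp (- 4 t / (\<delta> m\<^sup>2))\<close>. With \<open>u = m / N\<close> and
  \<open>x\<^sup>3 = 4 t / (\<delta> N\<^sup>2)\<close> the last term is \<open>exp (- x\<^sup>3 / u\<^sup>2)\<close>, which is at most
  \<open>exp (u / 2 - 7 x / 6)\<close>, and \<open>exp (u / 2)\<close> has expectation \<open>1 + exp (1 / (2 N))\<close>. The surplus
  factor \<open>exp (- x / 6)\<close> absorbs the power of \<open>t\<close>, so the term with constant \<open>c\<close>
  suffices on its own.
\<close>

section \<open>Matrix exponentials over a finite index set\<close>

text \<open>The sum of all absolute entries dominates every row sum, so each unfolding of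
  \<open>mat_pow\<close> costs at most this factor. The bound is crude, but it makes the exponential
  series converge.\<close>

lemma abs_mat_pow_le:
  assumes "finite S" "v \<in> S"
  shows "\<bar>mat_pow S M k v w\<bar> \<le> (\<Sum>x\<in>S. \<Sum>y\<in>S. \<bar>M x y\<bar>) ^ k"
  using assms(2)
proof (induction k arbitrary: v)
  case (Suc k)
  let ?B = "\<Sum>x\<in>S. \<Sum>y\<in>S. \<bar>M x y\<bar>"
  have "\<bar>mat_pow S M (Suc k) v w\<bar> \<le> (\<Sum>u\<in>S. \<bar>M v u * mat_pow S M k u w\<bar>)"
    by (simp add: sum_abs)
  also have "\<dots> \<le> (\<Sum>u\<in>S. \<bar>M v u\<bar> * ?B ^ k)"
    using Suc.IH by (intro sum_mono) (auto simp: abs_mult intro!: mult_left_mono)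
  also have "\<dots> = (\<Sum>u\<in>S. \<bar>M v u\<bar>) * ?B ^ k"
    by (simp add: sum_distrib_right)
  also have "(\<Sum>u\<in>S. \<bar>M v u\<bar>) \<le> ?B"
    using Suc.prems assms(1)
    by (intro member_le_sum[where f="\<lambda>x. \<Sum>y\<in>S. \<bar>M x y\<bar>"]) (auto intro: sum_nonneg)
  then have "(\<Sum>u\<in>S. \<bar>M v u\<bar>) * ?B ^ k \<le> ?B * ?B ^ k"
    by (intro mult_right_mono zero_le_power sum_nonneg) auto
  finally show ?case by simp
qed auto

lemma summable_mat_exp:
  assumes "finite S" "v \<in> S"
  shows "summable (\<lambda>k. mat_pow S M k v w / fact k * t ^ k)"
proof (rule summable_comparison_test')
  let ?B = "\<Sum>x\<in>S. \<Sum>y\<in>S. \<bar>M x y\<bar>"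
  show "summable (\<lambda>k. inverse (fact k) * (?B * \<bar>t\<bar>) ^ k)"
    by (rule summable_exp)
  show "norm (mat_pow S M k v w / fact k * t ^ k) \<le> inverse (fact k) * (?B * \<bar>t\<bar>) ^ k" for k
    using mult_right_mono[OF abs_mat_pow_le[OF assms, of M k w], of "\<bar>t\<bar> ^ k / fact k"]
    by (simp add: abs_mult power_abs power_mult_distrib field_simps)
qed

lemma mat_pow_scale: "mat_pow S (\<lambda>x y. c * M x y) k v w = c ^ k * mat_pow S M k v w"
  by (induction k arbitrary: v) (auto simp: sum_distrib_left mult_ac)

lemma mat_exp_scale: "mat_exp S (\<lambda>x y. t * M x y) v w = (\<Sum>k. mat_pow S M k v w / fact k * t ^ k)"
  by (simp add: mat_exp_def mat_pow_scale mult_ac)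

text \<open>The backward equation. Differentiating term by term cancels one factor of the factorial,
  and the recursion of \<open>mat_pow\<close> then splits off \<open>M\<close> on the left.\<close>

lemma has_field_derivative_mat_exp:
  assumes "finite S" "v \<in> S"
  shows "((\<lambda>t. mat_exp S (\<lambda>x y. t * M x y) v w) has_real_derivative
    (\<Sum>u\<in>S. M v u * mat_exp S (\<lambda>x y. t * M x y) u w)) (at t)"
proof -
  let ?c = "\<lambda>v k. mat_pow S M k v w / fact k :: real"
  have "diffs (?c v) k * t ^ k = (\<Sum>u\<in>S. M v u * (?c u k * t ^ k))" for k
    by (simp add: diffs_def sum_distrib_right sum_divide_distrib sum_distrib_left field_simps
        del: of_nat_Suc)
  moreover have "(\<lambda>k. \<Sum>u\<in>S. M v u * (?c u k * t ^ k)) sums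
      (\<Sum>u\<in>S. M v u * (\<Sum>k. ?c u k * t ^ k))"
    using assms(1) by (intro sums_sum sums_mult summable_sums summable_mat_exp) auto
  ultimately have "(\<Sum>k. diffs (?c v) k * t ^ k) = (\<Sum>u\<in>S. M v u * (\<Sum>k. ?c u k * t ^ k))"
    by (simp add: sums_iff)
  with termdiffs_strong_converges_everywhere[OF summable_mat_exp[OF assms, of M w], of t]
  show ?thesis by (simp add: mat_exp_scale)
qed

lemma mat_exp_zero: "mat_exp S (\<lambda>x y. 0 * M x y) v w = (if v = w then 1 else 0)"
proof -
  have "(\<Sum>k. mat_pow S M k v w / fact k * 0 ^ k) = mat_pow S M 0 v w"
    using powser_zero[of "\<lambda>k. mat_pow S M k v w / fact k"] by simp
  then show ?thesis unfolding mat_exp_scale by simp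
qed

text \<open>An energy estimate replaces diagonalisation. The deviation of column \<open>z\<close>
  from the uniform vector keeps sum zero, so \<open>gap\<close> makes its squared norm decay at rate
  \<open>2 * \<kappa>\<close> from an initial value of at most 1; the entry at \<open>z\<close> is
  one coordinate of it.\<close>

lemma mat_exp_le_spectral_gap:
  fixes L :: "'v \<Rightarrow> 'v \<Rightarrow> real" and \<kappa> t :: real
  assumes "finite S" and "z \<in> S"
    and row: "\<And>v. v \<in> S \<Longrightarrow> (\<Sum>w\<in>S. L v w) = 0"
    and col: "\<And>w. w \<in> S \<Longrightarrow> (\<Sum>v\<in>S. L v w) = 0"
    and gap: "\<And>f. (\<Sum>v\<in>S. f v) = 0 \<Longrightarrow>
      \<kappa> * (\<Sum>v\<in>S. (f v)\<^sup>2) \<le> (\<Sum>v\<in>S. f v * (\<Sum>w\<in>S. L v w * f w))"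
    and "0 \<le> t"
  shows "mat_exp S (\<lambda>x y. - t * L x y) z z \<le> 1 / card S + exp (- \<kappa> * t)"
proof -
  define m where "m = real (card S)"
  have m: "m \<ge> 1"
    unfolding m_def using assms(1,2)
    by (metis One_nat_def Suc_leI card_gt_0_iff empty_iff of_nat_1 of_nat_mono)
  define e where "e = (\<lambda>t v. mat_exp S (\<lambda>x y. t * (- L x y)) v z)"
  define f where "f = (\<lambda>t v. e t v - 1 / m)"
  have e': "((\<lambda>t. e t v) has_real_derivative (\<Sum>w\<in>S. - L v w * e t w)) (at t)" if "v \<in> S" for v t
    unfolding e_def 
    using has_field_derivative_mat_exp[OF assms(1) that, of "\<lambda>x y. - L x y" z] by simp
  have e0: "e 0 v = (if v = z then 1 else 0)" for v
    unfolding e_def by (rule mat_exp_zero)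
  \<comment> \<open>Vanishing column sums conserve the total mass of \<open>e t\<close>, so it stays
    1 and \<open>f t\<close> remains in the domain of \<open>gap\<close>.\<close>
  have "((\<lambda>t. \<Sum>v\<in>S. e t v) has_real_derivative 0) (at t)" for t
  proof -
    have "(\<Sum>v\<in>S. \<Sum>w\<in>S. - L v w * e t w) = (\<Sum>w\<in>S. (\<Sum>v\<in>S. - L v w) * e t w)"
      unfolding sum_distrib_right by (rule sum.swap)
    also have "\<dots> = 0" using col by (simp add: sum_negf)
    finally show ?thesis
      using DERIV_sum[OF e', of S "\<lambda>v. v" t] by simp
  qed
  then have "(\<Sum>v\<in>S. e t v) = (\<Sum>v\<in>S. e 0 v)" for t
    using DERIV_isconst_all[of "\<lambda>t. \<Sum>v\<in>S. e t v"] by blast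
  then have "(\<Sum>v\<in>S. e t v) = 1" for t
    using assms(1,2) by (simp add: e0)
  then have f_sum: "(\<Sum>v\<in>S. f t v) = 0" for t
    using m by (simp add: f_def sum_subtractf m_def)
  have f': "((\<lambda>t. f t v) has_real_derivative - (\<Sum>w\<in>S. L v w * f t w)) (at t)"
    if "v \<in> S" for v t
  proof -
    \<comment> \<open>Vanishing row sums put constants into the kernel of \<open>L\<close>, so
      \<open>f\<close> solves the same equation as \<open>e\<close>.\<close>
    have "(\<Sum>w\<in>S. L v w * f t w) = (\<Sum>w\<in>S. L v w * e t w)"
      using row[OF that]
      by (simp add: f_def right_diff_distrib sum_subtractf flip: sum_divide_distrib)
    then show ?thesis
      unfolding f_def using DERIV_diff[OF e'[OF that, of t] DERIV_const[of "1 / m"]]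
      by (simp add: sum_negf)
  qed
  \<comment> \<open>The exponential weight compensates exactly the decay that \<open>gap\<close>
    guarantees, which makes \<open>\<phi>\<close> nonincreasing.\<close>
  define \<phi> where "\<phi> = (\<lambda>t. exp (2 * \<kappa> * t) * (\<Sum>v\<in>S. (f t v)\<^sup>2))"
  have "\<phi> t \<le> \<phi> 0"
  proof (rule DERIV_nonpos_imp_nonincreasing[OF \<open>0 \<le> t\<close>])
    fix s :: real
    let ?D = "\<lambda>s. \<Sum>v\<in>S. 2 * f s v * - (\<Sum>w\<in>S. L v w * f s w)"
    have d: "((\<lambda>s. \<Sum>v\<in>S. (f s v)\<^sup>2) has_real_derivative ?D s) (at s)"
      using f' by (intro DERIV_sum) (auto intro!: derivative_eq_intros)
    have "((\<lambda>s. exp (2 * \<kappa> * s)) has_real_derivative exp (2 * \<kappa> * s) * (2 * \<kappa>)) (at s)"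
      by (auto intro!: derivative_eq_intros)
    from DERIV_mult[OF this d] have "(\<phi> has_real_derivative
        exp (2 * \<kappa> * s) * (2 * \<kappa> * (\<Sum>v\<in>S. (f s v)\<^sup>2) + ?D s)) (at s)"
      by (simp add: \<phi>_def algebra_simps)
    moreover have "2 * \<kappa> * (\<Sum>v\<in>S. (f s v)\<^sup>2) + ?D s \<le> 0"
      using gap[OF f_sum, of s] by (simp add: sum_negf mult.assoc flip: sum_distrib_left)
    ultimately show "\<exists>y. (\<phi> has_real_derivative y) (at s) \<and> y \<le> 0"
      by (meson exp_ge_zero mult_nonneg_nonpos)
  qed
  moreover have "\<phi> 0 \<le> 1"
  proof -
    \<comment> \<open>The square at \<open>z\<close> is \<open>1 - 2 / m + 1 / m\<^sup>2\<close>;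
      every other square is \<open>1 / m\<^sup>2\<close>.\<close>
    have "\<phi> 0 = (\<Sum>v\<in>S. (if v = z then 1 - 2 / m else 0) + 1 / m\<^sup>2)"
      unfolding \<phi>_def f_def e0 by (auto simp: power2_eq_square algebra_simps intro!: sum.cong)
    also have "\<dots> = 1 - 1 / m"
      using assms(1,2) m 
      by (subst sum.distrib) (simp add: m_def[symmetric] power2_eq_square field_simps)
    finally show ?thesis using m by simp
  qed
  ultimately have "\<phi> t \<le> 1" by linarith
  moreover have "(f t z)\<^sup>2 \<le> (\<Sum>v\<in>S. (f t v)\<^sup>2)"
    using assms(1,2) by (intro member_le_sum) auto
  then have "exp (2 * \<kappa> * t) * (f t z)\<^sup>2 \<le> \<phi> t"
    unfolding \<phi>_def by simp
  ultimately have "(exp (\<kappa> * t) * f t z)\<^sup>2 \<le> 1\<^sup>2"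
    by (simp add: power_mult_distrib exp_double[symmetric] mult.assoc)
  then have "exp (\<kappa> * t) * f t z \<le> 1"
    by (rule power2_le_imp_le) simp
  then have "f t z \<le> exp (- \<kappa> * t)"
    by (simp add: exp_minus field_simps)
  then show ?thesis
    by (simp add: f_def e_def m_def)
qed

section \<open>Spectral gap of a finite cluster\<close>

text \<open>Popoviciu's variance inequality. With minimum \<open>a\<close> and maximum
  \<open>b\<close>, each \<open>(f v - a) * (b - f v)\<close> is nonnegative. In the sum over
  \<open>S\<close> the linear part vanishes, and \<open>- 4 * a * b\<close> is at most the square of
  \<open>b - a\<close>.\<close>

lemma sum_squares_le_oscillation:
  fixes f :: "'a \<Rightarrow> real"
  assumes "finite S" and "(\<Sum>v\<in>S. f v) = 0"
    and osc: "\<And>v w. v \<in> S \<Longrightarrow> w \<in> S \<Longrightarrow> (f v - f w)\<^sup>2 \<le> D"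
  shows "(\<Sum>v\<in>S. (f v)\<^sup>2) \<le> real (card S) * D / 4"
proof (cases "S = {}")
  case False
  define a b where "a = Min (f ` S)" and "b = Max (f ` S)"
  have ab: "a \<in> f ` S" "b \<in> f ` S" "\<And>v. v \<in> S \<Longrightarrow> a \<le> f v \<and> f v \<le> b"
    unfolding a_def b_def using assms(1) False by auto
  have "0 \<le> (\<Sum>v\<in>S. (f v - a) * (b - f v))"
    using ab(3) by (intro sum_nonneg mult_nonneg_nonneg) auto
  also have "\<dots> = (\<Sum>v\<in>S. (a + b) * f v - (f v)\<^sup>2 - a * b)"
    by (intro sum.cong) (auto simp: algebra_simps power2_eq_square)
  also have "\<dots> = - (\<Sum>v\<in>S. (f v)\<^sup>2) - card S * (a * b)"
    using assms(2) by (simp add: sum_subtractf flip: sum_distrib_left)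
  finally have "(\<Sum>v\<in>S. (f v)\<^sup>2) \<le> card S * (- (a * b))" by simp
  also have "- (a * b) \<le> D / 4"
  proof -
    have "(b - a)\<^sup>2 \<le> D" using ab(1,2) osc by auto
    moreover have "(b - a)\<^sup>2 + 4 * (a * b) = (a + b)\<^sup>2" by (simp add: power2_eq_square algebra_simps)
    ultimately show ?thesis using zero_le_power2[of "a + b"] by linarith
  qed
  finally show ?thesis by (simp add: mult_left_mono)
qed simp

text \<open>Telescoping along a simple path and Cauchy-Schwarz. The double sum contains each path
  edge in both orientations, whence the division by 2.\<close>

lemma square_diff_le_dirichlet:
  fixes f :: "'v \<Rightarrow> real"
  assumes fin: "finite (component H x)" and y: "y \<in> component H x"
  shows "(f x - f y)\<^sup>2 \<le> card (component H x) *
    (\<Sum>v\<in>component H x. \<Sum>w\<in>component H x. if {v, w} \<in> H then (f v - f w)\<^sup>2 else 0) / 2"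
proof -
  define S where "S = component H x"
  let ?R = "\<lambda>v w. {v, w} \<in> H"
  have "?R\<^sup>*\<^sup>* x y"
    using y by (simp add: component_def rtranclp_rtrancl_eq)
  then obtain xs where "rtrancl_path ?R x xs y"
    by (auto simp: rtranclp_eq_rtrancl_path)
  then obtain xs where path: "rtrancl_path ?R x xs y" and dist: "distinct (x # xs)"
    by (rule rtrancl_path_distinct)
  \<comment> \<open>The list \<open>xs\<close> omits the starting vertex, so its length
    \<open>n\<close> counts edges and \<open>p\<close> runs through
    \<open>p 0, ..., p n\<close>.\<close>
  define p where "p = (\<lambda>i. (x # xs) ! i)"
  define n where "n = length xs"
  have step: "{p i, p (Suc i)} \<in> H" if "i < n" for i
    using rtrancl_path_nth[OF path, of i] that by (simp add: p_def n_def)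
  have p0: "p 0 = x" by (simp add: p_def)
  have pn: "p n = y"
  proof (cases "xs = []")
    case True
    then show ?thesis using path by (auto simp: p_def n_def elim: rtrancl_path.cases)
  next
    case False
    then show ?thesis using rtrancl_path_last[OF path]
      by (simp add: p_def n_def last_conv_nth nth_Cons')
  qed
  have inj: "inj_on p {..n}"
    using dist unfolding p_def n_def inj_on_def
    by (auto simp: nth_eq_iff_index_eq simp del: distinct.simps)
  have pS: "p i \<in> S" if "i \<le> n" for i
    using that
  proof (induction i)
    case 0
    then show ?case by (simp add: p0 S_def component_def)
  next
    case (Suc i)
    then show ?case using step[of i]
      by (auto simp: S_def component_def intro: rtrancl_into_rtrancl)
  qed
  have "card (p ` {..n}) \<le> card S"
    using fin pS by (intro card_mono) (auto simp: S_def)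
  then have nS: "real n \<le> card S"
    by (simp add: card_image[OF inj])
  \<comment> \<open>The path edges oriented forwards and backwards. Distinctness of the vertices
    makes these \<open>2 * n\<close> ordered pairs distinct, so both copies of the path energy fit
    into the sum over \<open>S \<times> S\<close>.\<close>
  define A where "A = (\<lambda>i. (p i, p (Suc i))) ` {..<n}"
  define B where "B = (\<lambda>i. (p (Suc i), p i)) ` {..<n}"
  define g where "g = (\<lambda>(v, w). if {v, w} \<in> H then (f v - f w)\<^sup>2 else 0)"
  have peq: "p i = p j \<longleftrightarrow> i = j" if "i \<le> n" "j \<le> n" for i j
    using inj that by (auto simp: inj_on_def)
  have "sum g A = (\<Sum>i<n. (f (p (Suc i)) - f (p i))\<^sup>2)"
    unfolding A_def using step
    by (subst sum.reindex) (auto simp: inj_on_def peq g_def power2_commute intro!: sum.cong)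
  moreover have "sum g B = (\<Sum>i<n. (f (p (Suc i)) - f (p i))\<^sup>2)"
    unfolding B_def using step
    by (subst sum.reindex) (auto simp: inj_on_def peq g_def insert_commute intro!: sum.cong)
  moreover have "A \<inter> B = {}"
    unfolding A_def B_def by (auto simp: peq)
  then have "sum g (A \<union> B) = sum g A + sum g B"
    by (intro sum.union_disjoint) (auto simp: A_def B_def)
  moreover have "sum g (A \<union> B) \<le> sum g (S \<times> S)"
    using fin by (intro sum_mono2) (auto simp: A_def B_def S_def[symmetric] g_def intro!: pS)
  ultimately have "2 * (\<Sum>i<n. (f (p (Suc i)) - f (p i))\<^sup>2) \<le> sum g (S \<times> S)"
    by simp
  then have le: "2 * (\<Sum>i<n. (f (p (Suc i)) - f (p i))\<^sup>2)
      \<le> (\<Sum>v\<in>S. \<Sum>w\<in>S. if {v, w} \<in> H then (f v - f w)\<^sup>2 else 0)"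
    by (simp add: g_def sum.cartesian_product)
  have "f y - f x = (\<Sum>i<n. f (p (Suc i)) - f (p i))"
    by (simp add: sum_lessThan_telescope[of "\<lambda>i. f (p i)"] p0 pn)
  then have "(f x - f y)\<^sup>2 = (\<Sum>i<n. f (p (Suc i)) - f (p i))\<^sup>2"
    by (metis power2_commute)
  also have "\<dots> \<le> real n * (\<Sum>i<n. (f (p (Suc i)) - f (p i))\<^sup>2)"
    using sum_squared_le_sum_of_squares[of "\<lambda>i. f (p (Suc i)) - f (p i)" "{..<n}"]
    by (simp add: mult.commute)
  also have "\<dots> \<le> card S * (\<Sum>i<n. (f (p (Suc i)) - f (p i))\<^sup>2)"
    using nS by (intro mult_right_mono sum_nonneg) auto
  also have "\<dots> \<le> card S * ((\<Sum>v\<in>S. \<Sum>w\<in>S. if {v, w} \<in> H then (f v - f w)\<^sup>2 else 0) / 2)"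
    using le by (intro mult_left_mono) auto
  finally show ?thesis by (simp add: S_def)
qed

text \<open>The loops of the regularisation turn \<open>I - A\<close> into
  \<open>1 / \<delta>\<close> times the combinatorial Laplacian of the cluster. Its Dirichlet form
  is compared with the square norm by the two preceding lemmas.\<close>

lemma rrw_return_prob_le:
  assumes "simple_graph V E" and "\<delta> > 0" and "finite (cluster E \<omega> v)" and "0 \<le> t"
  shows "rrw_return_prob \<delta> E \<omega> t v \<le> 1 / card (cluster E \<omega> v)
    + exp (- (4 * t / (\<delta> * (card (cluster E \<omega> v))\<^sup>2)))"
proof -
  define H where "H = open_edges E \<omega>"
  define S where "S = cluster E \<omega> v"
  have S_eq: "S = component H v" by (simp add: S_def cluster_def H_def)
  have fin: "finite S" using assms(3) by (simp add: S_def)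
  have vS: "v \<in> S" by (simp add: S_eq component_def)
  define m where "m = real (card S)"
  have m: "m > 0" using fin vS by (auto simp: m_def card_gt_0_iff)
  have loop: "{x} \<notin> H" for x
    using assms(1) by (auto simp: H_def open_edges_def simple_graph_def)
  have closed: "y \<in> S" if "x \<in> S" "{x, y} \<in> H" for x y
    using that by (auto simp: S_eq component_def intro: rtrancl_into_rtrancl)
  \<comment> \<open>The path bound is stated from a base point, and it is needed for all pairs in
    \<open>S\<close>.\<close>
  have comp_S: "component H x = S" if "x \<in> S" for x
  proof -
    have "sym {(x, y). {x, y} \<in> H}" by (auto simp: sym_def insert_commute)
    then have "sym ({(x, y). {x, y} \<in> H}\<^sup>*)" by (rule sym_rtrancl)
    then show ?thesis using that
      unfolding S_eq component_def by (auto dest: symD intro: rtrancl_trans)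
  qed
  define A where "A = (\<lambda>x y. if {x, y} \<in> H then 1 else 0 :: real)"
  have A_sym: "A x y = A y x" for x y by (simp add: A_def insert_commute)
  define L where "L = (\<lambda>x y. (if x = y then 1 else 0) - rrw_matrix \<delta> H x y)"
  have deg: "card (nbrs H x) = (\<Sum>y\<in>S. A x y)" if "x \<in> S" for x
  proof -
    have "nbrs H x = {y \<in> S. {x, y} \<in> H}" using closed[OF that] by (auto simp: nbrs_def)
    then show ?thesis using fin by (simp add: A_def sum.If_cases Int_def)
  qed
  have L_eq: "L x y = ((if x = y then real (card (nbrs H x)) else 0) - A x y) / \<delta>" for x y
    using assms(2) loop by (auto simp: L_def rrw_matrix_def A_def field_simps)
  have L_sym: "L x y = L y x" for x y by (auto simp: L_eq A_sym)
  have row: "(\<Sum>y\<in>S. L x y) = 0" if "x \<in> S" for x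
    using that fin deg[OF that]
    by (simp add: L_eq sum_subtractf flip: sum_divide_distrib)
  have L_apply: "(\<Sum>y\<in>S. L x y * f y) = (\<Sum>y\<in>S. A x y * (f x - f y)) / \<delta>" if "x \<in> S" for f x
  proof -
    \<comment> \<open>Subtracting \<open>f x\<close> times the zero row sum makes the diagonal term
      vanish; off the diagonal \<open>L\<close> is \<open>- A / \<delta>\<close>.\<close>
    have "(\<Sum>y\<in>S. L x y * f y) = (\<Sum>y\<in>S. L x y * f y) - f x * (\<Sum>y\<in>S. L x y)"
      by (simp add: row[OF that])
    also have "\<dots> = (\<Sum>y\<in>S. L x y * (f y - f x))"
      by (simp add: sum_distrib_left sum_subtractf algebra_simps)
    also have "\<dots> = (\<Sum>y\<in>S. A x y * (f x - f y) / \<delta>)"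
      by (intro sum.cong) (auto simp: L_eq diff_divide_distrib algebra_simps)
    finally show ?thesis by (simp add: sum_divide_distrib)
  qed
  have dirichlet: "(\<Sum>x\<in>S. f x * (\<Sum>y\<in>S. L x y * f y))
      = (\<Sum>x\<in>S. \<Sum>y\<in>S. if {x, y} \<in> H then (f x - f y)\<^sup>2 else 0) / (2 * \<delta>)" for f
  proof -
    define X where "X = (\<Sum>x\<in>S. \<Sum>y\<in>S. A x y * (f x * (f x - f y)))"
    \<comment> \<open>Exchanging the roles of the endpoints and averaging the two forms of
      \<open>X\<close> completes the square.\<close>
    have "X = (\<Sum>x\<in>S. \<Sum>y\<in>S. A x y * (f y * (f y - f x)))"
      unfolding X_def by (subst sum.swap) (simp add: A_sym)
    then have "2 * X = (\<Sum>x\<in>S. \<Sum>y\<in>S. A x y * (f x * (f x - f y)) + A x y * (f y * (f y - f x)))"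
      by (simp add: sum.distrib X_def)
    also have "\<dots> = (\<Sum>x\<in>S. \<Sum>y\<in>S. if {x, y} \<in> H then (f x - f y)\<^sup>2 else 0)"
      by (intro sum.cong) (auto simp: A_def power2_eq_square algebra_simps)
    finally have X: "X = (\<Sum>x\<in>S. \<Sum>y\<in>S. if {x, y} \<in> H then (f x - f y)\<^sup>2 else 0) / 2"
      by simp
    have "(\<Sum>x\<in>S. f x * (\<Sum>y\<in>S. L x y * f y)) = X / \<delta>"
      unfolding X_def sum_divide_distrib
      by (intro sum.cong) (simp_all only: L_apply, simp_all add: sum_distrib_left sum_divide_distrib mult_ac)
    then show ?thesis by (simp add: X)
  qed
  have "mat_exp S (\<lambda>x y. - t * L x y) v v \<le> 1 / card S + exp (- (4 / (\<delta> * m\<^sup>2)) * t)"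
  proof (rule mat_exp_le_spectral_gap)
    fix f :: "'a \<Rightarrow> real" assume f: "(\<Sum>x\<in>S. f x) = 0"
    define Q where "Q = (\<Sum>x\<in>S. \<Sum>y\<in>S. if {x, y} \<in> H then (f x - f y)\<^sup>2 else 0)"
    have "(f x - f y)\<^sup>2 \<le> m * Q / 2" if "x \<in> S" "y \<in> S" for x y
      using square_diff_le_dirichlet[of H x y f] that fin comp_S[OF \<open>x \<in> S\<close>]
      by (simp add: m_def Q_def)
    from sum_squares_le_oscillation[OF fin f this]
    \<comment> \<open>The oscillation bound \<open>m * D / 4\<close> with
      \<open>D = m * Q / 2\<close>; this yields the constant 4 of the gap.\<close>
    have "(\<Sum>x\<in>S. (f x)\<^sup>2) \<le> m\<^sup>2 * Q / 8"
      by (simp add: m_def power2_eq_square)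
    then have "4 / (\<delta> * m\<^sup>2) * (\<Sum>x\<in>S. (f x)\<^sup>2) \<le> 4 / (\<delta> * m\<^sup>2) * (m\<^sup>2 * Q / 8)"
      by (intro mult_left_mono) auto
    also have "\<dots> = Q / (2 * \<delta>)" using m by simp
    finally show "4 / (\<delta> * m\<^sup>2) * (\<Sum>x\<in>S. (f x)\<^sup>2) \<le> (\<Sum>x\<in>S. f x * (\<Sum>y\<in>S. L x y * f y))"
      by (simp add: dirichlet Q_def)
  next
    show "(\<Sum>x\<in>S. L x y) = 0" if "y \<in> S" for y
      using row[OF that] by (subst L_sym)
  qed (use fin vS row assms(4) in auto)
  then show ?thesis
    by (simp add: rrw_return_prob_def S_def[symmetric] L_def H_def m_def)
qed

section \<open>Numerical estimates for the main term\<close>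

text \<open>For fixed \<open>x\<close> the minimum of \<open>u / 2 + x ^ 3 / u\<^sup>2\<close> is
  \<open>x\<close> times 3/4 of the cube root of 4, about 1.19. The smaller 7/6 is rational and
  still leaves a surplus of 1/6 over 1.\<close>

lemma exponent_bound:
  fixes x u :: real
  assumes "x > 0" and "u > 0"
  shows "- (x ^ 3 / u\<^sup>2) \<le> u / 2 - 7 / 6 * x"
proof -
  \<comment> \<open>The cubic in \<open>u\<close> has its positive critical point at
    \<open>14 / 9 * x\<close>, with value \<open>86 / 243 * x ^ 3\<close>; hence the double root
    after subtracting that value.\<close>
  have "3 * u ^ 3 - 7 * x * u\<^sup>2 + 6 * x ^ 3
      = (u - 14 / 9 * x)\<^sup>2 * (3 * u + 7 / 3 * x) + 86 / 243 * x ^ 3"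
    by (simp add: power2_eq_square power3_eq_cube field_simps)
  also have "\<dots> \<ge> 0" using assms by (intro add_nonneg_nonneg mult_nonneg_nonneg) auto
  finally have "0 \<le> (3 * u ^ 3 - 7 * x * u\<^sup>2 + 6 * x ^ 3) / (6 * u\<^sup>2)" by simp
  also have "\<dots> = u / 2 - 7 / 6 * x + x ^ 3 / u\<^sup>2"
    using assms by (simp add: field_simps power2_eq_square power3_eq_cube)
  finally show ?thesis by simp
qed

text \<open>The tangent to \<open>ln\<close> at 4 has slope 1/4, which an exponent of at most 2/3
  turns into 1/6.\<close>

lemma powr_le_exp_sixth:
  fixes x y :: real
  assumes "x > 0" and "0 \<le> y" and "y \<le> 2 / 3"
  shows "x powr y \<le> 7 / 5 * exp (x / 6)"
proof -
  have "ln (x / 4) \<le> x / 4 - 1" using assms(1) by (intro ln_le_minus_one) simp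
  moreover have "ln (x / 4) = ln x - 2 * ln 2"
    using assms(1) ln_realpow[of 2 2] by (simp add: ln_div)
  ultimately have "ln x \<le> x / 4 + 2 / 5" using ln2_le_25_over_36 by linarith
  then have "y * ln x \<le> y * (x / 4 + 2 / 5)" by (intro mult_left_mono assms)
  also have "\<dots> \<le> 2 / 3 * (x / 4 + 2 / 5)" using assms by (intro mult_right_mono) auto
  finally have "exp (y * ln x) \<le> exp (x / 6 + 4 / 15)" by simp
  also have "\<dots> = exp (x / 6) * exp (4 / 15)" by (rule exp_add)
  also have "exp (4 / 15 :: real) \<le> 7 / 5"
  proof -
    have "1 \<le> 15 / 11 * exp (- (4 / 15) :: real)"
      using exp_ge_add_one_self[of "- (4 / 15) :: real"] by simp
    then have "exp (4 / 15 :: real) \<le> 15 / 11" by (simp add: exp_minus field_simps)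
    then show ?thesis by linarith
  qed
  finally show ?thesis using assms(1) by (simp add: powr_def mult.commute)
qed

text \<open>Since \<open>pi\<close> exceeds 9/4 and the denominator is at most 2, the fraction is at
  least \<open>3 / 4 * sqrt \<delta>\<close>. This suffices both when the left side is at most 1 and
  when it is at most \<open>sqrt \<delta> / 2\<close>.\<close>

lemma quarter_powr_le:
  fixes \<delta> p \<nu> :: real
  assumes "\<delta> \<ge> 1" and "0 \<le> p" and "p \<le> 1 / 2" and "0 \<le> \<nu>"
  shows "(\<delta> / 4) powr p \<le> 2 / 3 * (1 + sqrt (pi * \<delta>) / 2 powr (1 - \<nu>))"
proof -
  define b where "b = sqrt (pi * \<delta>) / 2 powr (1 - \<nu>)"
  have "3 / 2 * sqrt \<delta> = sqrt (9 / 4 * \<delta>)"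
    by (simp add: real_sqrt_mult real_sqrt_divide)
  also have "\<dots> \<le> sqrt (pi * \<delta>)"
    using assms(1) pi_gt3 by (intro real_sqrt_le_mono mult_right_mono) auto
  finally have "3 / 2 * sqrt \<delta> / 2 \<le> sqrt (pi * \<delta>) / 2" by simp
  also have "\<dots> \<le> sqrt (pi * \<delta>) / 2 powr (1 - \<nu>)"
    using assms powr_mono[of "1 - \<nu>" 1 2] by (intro divide_left_mono) auto
  finally have sq: "3 / 4 * sqrt \<delta> \<le> b" unfolding b_def by simp
  have "(\<delta> / 4) powr p \<le> 2 / 3 * (1 + b)"
  proof (cases "\<delta> \<le> 4")
    case True
    then have "(\<delta> / 4) powr p \<le> 1" using assms by (intro powr_le1) auto
    also have "1 \<le> 2 / 3 * (1 + b)"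
    proof -
      have "3 / 4 * 1 \<le> 3 / 4 * sqrt \<delta>" using assms(1) by (intro mult_left_mono) auto
      then have "3 / 4 \<le> b" using sq by (simp only: mult_1_right)
      then show ?thesis by simp
    qed
    finally show ?thesis .
  next
    case False
    then have "(\<delta> / 4) powr p \<le> (\<delta> / 4) powr (1 / 2)"
      using assms by (intro powr_mono) auto
    also have "\<dots> = sqrt \<delta> / 2" using assms(1) by (simp add: powr_half_sqrt real_sqrt_divide)
    also have "\<dots> \<le> 2 / 3 * (1 + b)" using sq by simp
    finally show ?thesis .
  qed
  then show ?thesis by (simp add: b_def)
qed

text \<open>Writing \<open>t\<close> through \<open>x\<close> splits \<open>t powr p\<close> into
  powers of \<open>\<delta> / 4\<close>, \<open>N\<close> and \<open>x\<close>. These are absorbed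
  by \<open>a\<close>, by the power of \<open>N + 1\<close> in \<open>c\<close>, and by the surplus
  \<open>exp (- x / 6)\<close>; the numerical constants multiply to less than
  \<open>exp 1\<close>.\<close>

lemma main_term_bound:
  fixes N \<delta> t \<nu> r a c x :: real
  assumes "N \<ge> 1" and "\<delta> \<ge> 1" and "t > 0" and "0 \<le> \<nu>" and "\<nu> \<le> 1 / 2"
    and r: "r = \<nu> / (1 + \<nu>)"
    and a: "a = 1 + sqrt (pi * \<delta>) / 2 powr (1 - \<nu>)"
    and c: "c = a * (1 + exp 1 * (1 + (N + 1) powr (1 / (1 + 2 * \<nu>))))"
    and x: "x = (4 * t / (\<delta> * N\<^sup>2)) powr (1 / 3)"
  shows "(1 + exp (1 / (2 * N))) * exp (- (7 / 6 * x)) \<le> c * t powr (- (1 / 6) * (1 + r)) * exp (- x)"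
proof -
  define p where "p = (1 + r) / 6"
  define W where "W = (N + 1) powr (1 / (1 + 2 * \<nu>))"
  have p: "0 \<le> p" "p \<le> 2 / 9"
    using assms(4,5) by (auto simp: p_def r field_simps)
  have xpos: "x > 0" using assms(1-3) by (simp add: x)
  have a1: "a \<ge> 1" using assms(2) by (simp add: a)
  have "x ^ 3 = 4 * t / (\<delta> * N\<^sup>2)"
    using assms(1-3) by (simp add: x powr_power)
  then have t: "t = \<delta> / 4 * N\<^sup>2 * x ^ 3"
    using assms(1-3) by (simp add: field_simps)
  have "t powr p = (\<delta> / 4) powr p * (N\<^sup>2) powr p * (x ^ 3) powr p"
    by (simp only: t powr_mult)
  also have "(N\<^sup>2) powr p = N powr (2 * p)"
    using assms(1) powr_powr[of N 2 p] by simp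
  also have "(x ^ 3) powr p = x powr (3 * p)"
    using xpos powr_powr[of x 3 p] by simp
  also have "(\<delta> / 4) powr p * N powr (2 * p) * x powr (3 * p)
      \<le> (2 / 3 * a) * W * (7 / 5 * exp (x / 6))"
  proof (intro mult_mono)
    show "(\<delta> / 4) powr p \<le> 2 / 3 * a"
      unfolding a using assms p by (intro quarter_powr_le) auto
    \<comment> \<open>After clearing denominators the next claim reads
      \<open>\<nu> + 4 * \<nu>\<^sup>2 \<le> 2\<close>.\<close>
    have "\<nu> * \<nu> \<le> 1 / 2 * (1 / 2)" using assms by (intro mult_mono) auto
    then have "2 * p \<le> 1 / (1 + 2 * \<nu>)"
      using assms(4,5) by (simp add: p_def r field_simps)
    then have "N powr (2 * p) \<le> N powr (1 / (1 + 2 * \<nu>))"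
      using assms(1) by (intro powr_mono) auto
    also have "\<dots> \<le> W"
      unfolding W_def using assms by (intro powr_mono2) auto
    finally show "N powr (2 * p) \<le> W" .
    show "x powr (3 * p) \<le> 7 / 5 * exp (x / 6)"
      using xpos p by (intro powr_le_exp_sixth) auto
  qed (use a1 in \<open>auto simp: W_def\<close>)
  finally have tp: "t powr p \<le> 14 / 15 * (a * W) * exp (x / 6)" by simp
  \<comment> \<open>The worst case is \<open>N = 1\<close>, where the square is
    \<open>exp 1\<close>; the square of 33/20 is 2.7225.\<close>
  have "exp (1 / (2 * N)) \<le> 33 / 20"
  proof (rule power2_le_imp_le)
    have "(exp (1 / (2 * N)))\<^sup>2 = exp (1 / N)"
      using exp_double[of "1 / (2 * N)"] by simp
    also have "\<dots> \<le> exp 1" using assms(1) by simp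
    also have "\<dots> \<le> (33 / 20)\<^sup>2" using e_less_272 by (simp add: power2_eq_square)
    finally show "(exp (1 / (2 * N)))\<^sup>2 \<le> (33 / 20)\<^sup>2" .
  qed simp
  then have "(1 + exp (1 / (2 * N))) * t powr p
      \<le> 53 / 20 * (14 / 15 * (a * W) * exp (x / 6))"
    using tp by (intro mult_mono) auto
  also have "\<dots> = 371 / 150 * ((a * W) * exp (x / 6))" by simp
  \<comment> \<open>The second-order Taylor bound gives \<open>exp 1 \<ge> 5 / 2\<close>, which
    exceeds 371/150.\<close>
  also have "\<dots> \<le> exp 1 * ((a * W) * exp (x / 6))"
    using exp_lower_Taylor_quadratic[of 1] a1
    by (intro mult_right_mono mult_nonneg_nonneg) (auto simp: W_def)
  also have "\<dots> = (a * (exp 1 * W)) * exp (x / 6)" by simp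
  \<comment> \<open>The product \<open>a * exp 1 * W\<close> is one of three nonnegative summands of
    \<open>c\<close>.\<close>
  also have "\<dots> \<le> c * exp (x / 6)"
    unfolding c W_def[symmetric] using a1
    by (intro mult_right_mono mult_left_mono) (auto simp: distrib_left add_nonneg_nonneg)
  finally have le: "(1 + exp (1 / (2 * N))) * t powr p * (t powr (- p) * exp (- (7 / 6 * x)))
      \<le> c * exp (x / 6) * (t powr (- p) * exp (- (7 / 6 * x)))"
    by (intro mult_right_mono) auto
  have "t powr p * t powr (- p) = 1"
    using assms(3) by (simp flip: powr_add)
  then have "(1 + exp (1 / (2 * N))) * exp (- (7 / 6 * x))
      = (1 + exp (1 / (2 * N))) * exp (- (7 / 6 * x)) * (t powr p * t powr (- p))"
    by (simp only: mult_1_right)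
  also have "\<dots> = (1 + exp (1 / (2 * N))) * t powr p * (t powr (- p) * exp (- (7 / 6 * x)))"
    by (simp only: mult_ac)
  also note le
  also have "c * exp (x / 6) * (t powr (- p) * exp (- (7 / 6 * x)))
      = c * t powr (- p) * (exp (x / 6) * exp (- (7 / 6 * x)))"
    by (simp only: mult_ac)
  also have "exp (x / 6) * exp (- (7 / 6 * x)) = exp (- x)"
    by (simp flip: exp_add)
  also have "- p = - (1 / 6) * (1 + r)" by (simp add: p_def)
  finally show ?thesis .
qed

section \<open>Expectations under the cluster size law\<close>

text \<open>The law is geometric with ratio \<open>q\<^sup>2\<close>, and normalisation forces
  \<open>C * q\<^sup>2 = 1 - q\<^sup>2\<close>. The weight is a power of \<open>1 / q\<close>, so
  the weighted series is geometric with ratio \<open>q\<close> and sums to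
  \<open>(1 + q) / q\<close>.\<close>

lemma exponential_law_moment:
  fixes N C :: real
  assumes "N > 0" and sums: "(\<lambda>k. C * exp (- real (Suc k) / N)) sums 1"
  shows "(\<lambda>k. exp (real (Suc k) / (2 * N)) * (C * exp (- real (Suc k) / N)))
    sums (1 + exp (1 / (2 * N)))"
proof -
  define q where "q = exp (- 1 / (2 * N))"
  have q: "0 < q" "q < 1" using assms(1) by (auto simp: q_def)
  have q2: "q\<^sup>2 < 1" using q by (simp add: power_less_one_iff)
  have pow: "q ^ k = exp (- real k / (2 * N))" for k
    by (simp add: q_def flip: exp_of_nat_mult)
  have "exp (- real (Suc k) / N) = q\<^sup>2 * (q\<^sup>2) ^ k" for k
  proof -
    have "q\<^sup>2 * (q\<^sup>2) ^ k = q ^ (2 + 2 * k)" by (simp add: power_mult power2_eq_square)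
    then show ?thesis using assms(1) by (simp only: pow) (simp add: field_simps)
  qed
  then have "(\<lambda>k. C * q\<^sup>2 * (q\<^sup>2) ^ k) sums 1" using sums by (simp add: mult.assoc)
  moreover have "(\<lambda>k. C * q\<^sup>2 * (q\<^sup>2) ^ k) sums (C * q\<^sup>2 * (1 / (1 - q\<^sup>2)))"
    using q2 by (intro sums_mult geometric_sums) simp
  ultimately have "C * q\<^sup>2 * (1 / (1 - q\<^sup>2)) = 1" by (rule sums_unique2[symmetric])
  then have C: "C * q\<^sup>2 = (1 - q) * (1 + q)"
    using q2 by (simp add: field_simps power2_eq_square)
  have "exp (real (Suc k) / (2 * N)) * exp (- real (Suc k) / N) = q * q ^ k" for k
  proof -
    have "q * q ^ k = exp (- real (Suc k) / (2 * N))" using pow[of "Suc k"] by simp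
    then show ?thesis using assms(1) by (simp only: flip: exp_add) (simp add: field_simps)
  qed
  then have "exp (real (Suc k) / (2 * N)) * (C * exp (- real (Suc k) / N)) = C * q * q ^ k" for k
    by (metis mult.assoc mult.left_commute)
  then have "(\<lambda>k. exp (real (Suc k) / (2 * N)) * (C * exp (- real (Suc k) / N)))
      sums (C * q * (1 / (1 - q)))"
    using q by (simp only:) (intro sums_mult geometric_sums, simp)
  also have "C * q * (1 / (1 - q)) = (C * q\<^sup>2) / (q * (1 - q))"
    using q by (simp add: field_simps power2_eq_square)
  also have "\<dots> = 1 + 1 / q" unfolding C using q by (simp add: field_simps)
  also have "1 / q = exp (1 / (2 * N))" by (simp add: q_def exp_minus field_simps)
  finally show ?thesis .
qed

text \<open>The sum over the atoms of \<open>X\<close> is formed with nonnegative integrals, so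
  integrability need not be shown beforehand. The value 0 of \<open>X\<close> is null and is left
  out of the series.\<close>

lemma expectation_le_discrete:
  fixes X :: "'a \<Rightarrow> nat" and h f :: "nat \<Rightarrow> real"
  assumes "prob_space M" and [measurable]: "X \<in> M \<rightarrow>\<^sub>M count_space UNIV"
    and pos: "AE \<omega> in M. X \<omega> \<ge> 1"
    and f: "\<And>k. k \<ge> 1 \<Longrightarrow> 0 \<le> f k \<and> f k \<le> h k"
    and sums: "(\<lambda>k. h (Suc k) * measure M {\<omega> \<in> space M. X \<omega> = Suc k}) sums B"
  shows "(\<integral>\<omega>. f (X \<omega>) \<partial>M) \<le> B"
proof -
  interpret prob_space M by fact
  let ?A = "\<lambda>k. {\<omega> \<in> space M. X \<omega> = Suc k}"
  have h: "0 \<le> h (Suc k)" for k using f[of "Suc k"] by simp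
  have "(\<integral>\<^sup>+\<omega>. ennreal (f (X \<omega>)) \<partial>M) \<le> (\<integral>\<^sup>+\<omega>. (\<Sum>k. ennreal (h (Suc k)) * indicator (?A k) \<omega>) \<partial>M)"
  proof (rule nn_integral_mono_AE)
    show "AE \<omega> in M. ennreal (f (X \<omega>)) \<le> (\<Sum>k. ennreal (h (Suc k)) * indicator (?A k) \<omega>)"
      using pos
    proof (rule AE_mp, intro AE_I2 impI)
      fix \<omega> assume \<omega>: "\<omega> \<in> space M" "1 \<le> X \<omega>"
      then obtain k where k: "X \<omega> = Suc k" by (cases "X \<omega>") auto
      have "ennreal (f (X \<omega>)) \<le> (\<Sum>k\<in>{k}. ennreal (h (Suc k)) * indicator (?A k) \<omega>)"
        using \<omega> k f[of "Suc k"] by (simp add: ennreal_leI)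
      also have "\<dots> \<le> (\<Sum>k. ennreal (h (Suc k)) * indicator (?A k) \<omega>)"
        by (intro sum_le_suminf summableI) auto
      finally show "ennreal (f (X \<omega>)) \<le> (\<Sum>k. ennreal (h (Suc k)) * indicator (?A k) \<omega>)" .
    qed
  qed
  also have "\<dots> = (\<Sum>k. ennreal (h (Suc k)) * emeasure M (?A k))"
    by (subst nn_integral_suminf) (auto intro!: suminf_cong nn_integral_cmult_indicator)
  also have "\<dots> = (\<Sum>k. ennreal (h (Suc k) * measure M (?A k)))"
    by (simp add: emeasure_eq_measure ennreal_mult h)
  also have "\<dots> = ennreal B"
    using sums h by (intro suminf_ennreal_eq) auto
  finally have le: "(\<integral>\<^sup>+\<omega>. ennreal (f (X \<omega>)) \<partial>M) \<le> ennreal B" .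
  have "0 \<le> B" by (rule sums_le[OF _ sums_zero sums]) (simp add: h)
  moreover have "(\<integral>\<omega>. f (X \<omega>) \<partial>M) = enn2real (\<integral>\<^sup>+\<omega>. ennreal (f (X \<omega>)) \<partial>M)"
    using pos f by (intro integral_eq_nn_integral) auto
  ultimately show ?thesis using le by (simp add: enn2real_leI)
qed

section \<open>The expected return probability\<close>

theorem theorem2p2:
  fixes V :: "'v set" and E :: "'v set set" and x\<^sub>0 :: 'v
    and \<Gamma> :: "('v \<Rightarrow> 'v) set" and \<mu> :: "('v set \<Rightarrow> bool) measure"
    and \<delta> N :: nat and C \<nu> r a c \<rho> t :: real
  assumes "simple_graph V E" and "infinite V" and "connected_graph V E"
    and "regular_graph V E \<delta>" and "x\<^sub>0 \<in> V"
    and "subgroup \<Gamma> (graph_aut_group V E)"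
    and "transitive_on_vertices V E \<Gamma>" and "unimodular V E \<Gamma>"
    and "invariant_percolation E \<Gamma> \<mu>"
    and "N > 0"
    and "(\<lambda>k. C * exp (- real (Suc k) / real N)) sums 1"
    and "\<And>m. m \<ge> 1 \<Longrightarrow>
      measure \<mu> {\<omega> \<in> space \<mu>. card (cluster E \<omega> x\<^sub>0) = m} = C * exp (- real m / real N)"
    and "\<nu> = 1 / ((real \<delta> - 1) * ln 16)"
    and "r = \<nu> / (1 + \<nu>)"
    and "a = 1 + sqrt (pi * real \<delta>) / 2 powr (1 - \<nu>)"
    and "c = a * (1 + exp 1 * (1 + (real N + 1) powr (1 / (1 + 2 * \<nu>))))"
    and "\<rho> = 4 powr ((1 + \<nu>)\<^sup>2 / (2 * \<nu>))"
    and "t \<ge> real \<delta> / (4 * real N)"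
  shows "(\<integral>\<omega>. rrw_return_prob \<delta> E \<omega> t x\<^sub>0 \<partial>\<mu>)
    \<le> (\<integral>\<omega>. 1 / real (card (cluster E \<omega> x\<^sub>0)) \<partial>\<mu>)
      + c * t powr (- (1 / 6) * (1 + r)) * exp (- ((4 * t / (real \<delta> * (real N)\<^sup>2)) powr (1 / 3)))
      + sqrt \<rho> * t powr (1 / 4) * exp (- (4 * sqrt t / (real \<delta> * \<rho>)))
      + exp (- (t / (16 * real N)))"
proof -
  interpret prob_space \<mu> using assms(9) by (simp add: invariant_percolation_def)
  define X where "X = (\<lambda>\<omega>. card (cluster E \<omega> x\<^sub>0))"
  have law: "prob {\<omega> \<in> space \<mu>. X \<omega> = Suc k} = C * exp (- real (Suc k) / real N)" for k
    using assms(12)[of "Suc k"] by (simp add: X_def)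
  \<comment> \<open>Every finite size thus has positive probability, as the measurability argument
    below requires.\<close>
  have "C > 0"
  proof (rule ccontr)
    assume "\<not> C > 0"
    then have "(1 :: real) \<le> 0"
      by (intro sums_le[OF _ assms(11) sums_zero]) (simp add: mult_nonpos_nonneg)
    then show False by simp
  qed
  \<comment> \<open>non-measurable sets have measure zero, so the law itself forces measurability\<close>
  then have sets: "{\<omega> \<in> space \<mu>. X \<omega> = Suc k} \<in> events" for k
    using law[of k] measure_notin_sets[of "{\<omega> \<in> space \<mu>. X \<omega> = Suc k}" \<mu>]
    by (metis exp_gt_zero mult_pos_pos order_less_irrefl)
  have "{\<omega> \<in> space \<mu>. X \<omega> = 0} = space \<mu> - (\<Union>k. {\<omega> \<in> space \<mu>. X \<omega> = Suc k})"
    using not0_implies_Suc by auto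
  then have "{\<omega> \<in> space \<mu>. X \<omega> = 0} \<in> events" using sets by auto
  then have "{\<omega> \<in> space \<mu>. X \<omega> = k} \<in> events" for k using sets by (cases k) auto
  then have [measurable]: "X \<in> \<mu> \<rightarrow>\<^sub>M count_space UNIV"
    by (subst measurable_count_space_eq2_countable)
      (auto simp: vimage_def Int_def conj_commute)
  \<comment> \<open>An infinite cluster has \<open>card\<close> equal to 0. The positive sizes carry
    total mass 1, so almost every cluster is finite.\<close>
  have "(\<lambda>k. prob {\<omega> \<in> space \<mu>. X \<omega> = Suc k}) sums prob (\<Union>k. {\<omega> \<in> space \<mu>. X \<omega> = Suc k})"
    using sets by (intro finite_measure_UNION) (auto simp: disjoint_family_on_def)
  then have "prob (\<Union>k. {\<omega> \<in> space \<mu>. X \<omega> = Suc k}) = 1"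
    using assms(11) unfolding law by (rule sums_unique2)
  then have X_pos: "AE \<omega> in \<mu>. X \<omega> \<ge> 1"
    by (rule AE_mp[OF AE_prob_1]) auto
  have "\<delta> \<noteq> 0"
  proof
    assume "\<delta> = 0"
    then have "nbrs E x\<^sub>0 = {}"
      using assms(4,5) unfolding regular_graph_def by (metis card_0_eq)
    then have no: "\<And>w. (x\<^sub>0, w) \<notin> {(x, y). {x, y} \<in> E}" by (auto simp: nbrs_def)
    have "component E x\<^sub>0 \<subseteq> {x\<^sub>0}"
      using no by (auto simp: component_def elim: converse_rtranclE)
    then show False
      using assms(2,3,5) unfolding connected_graph_def by (metis finite.simps finite_subset)
  qed
  then have \<delta>: "real \<delta> \<ge> 1" by simp
  have N: "real N \<ge> 1" using assms(10) by simp
  have "0 < real \<delta> / (4 * real N)" using \<delta> N by simp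
  then have t: "t > 0" using assms(18) by linarith
  \<comment> \<open>This crude bound on \<open>ln 16\<close> serves only to get
    \<open>\<nu> \<le> 1 / 2\<close>.\<close>
  have "exp 2 = exp (1 :: real) ^ 2" by (simp flip: exp_of_nat_mult)
  also have "\<dots> \<le> (272 / 100) ^ 2" using e_less_272 by (intro power_mono) auto
  also have "\<dots> \<le> (16 :: real)" by (simp add: power2_eq_square)
  finally have ln16: "ln (16 :: real) \<ge> 2" by (simp add: ln_ge_iff)
  have \<nu>: "0 \<le> \<nu>" "\<nu> \<le> 1 / 2"
  proof -
    show "0 \<le> \<nu>" using \<delta> ln16 by (simp add: assms(13))
    show "\<nu> \<le> 1 / 2"
    \<comment> \<open>For \<open>\<delta> = 1\<close> division by zero makes \<open>\<nu>\<close>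
      equal to 0.\<close>
    proof (cases "\<delta> = 1")
      case False
      then have "1 * 2 \<le> (real \<delta> - 1) * ln 16"
        using \<delta> ln16 by (intro mult_mono) auto
      then have "1 / ((real \<delta> - 1) * ln 16) \<le> 1 / 2" by (intro divide_left_mono) auto
      then show ?thesis by (simp add: assms(13))
    qed (simp add: assms(13))
  qed
  define x where "x = (4 * t / (real \<delta> * (real N)\<^sup>2)) powr (1 / 3)"
  have x: "x > 0" using t \<delta> N by (simp add: x_def)
  have x3: "x ^ 3 = 4 * t / (real \<delta> * (real N)\<^sup>2)"
    using t \<delta> N by (simp add: x_def powr_power)
  define g where "g = (\<lambda>k. exp (- (4 * t / (real \<delta> * (real k)\<^sup>2))))"
  have g: "g k \<le> exp (- (7 / 6 * x)) * exp (real k / (2 * real N))" if "k \<ge> 1" for k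
  proof -
    \<comment> \<open>Here \<open>exponent_bound\<close> is applied with \<open>u\<close> the
      cluster size in units of \<open>N\<close>.\<close>
    have "- (4 * t / (real \<delta> * (real k)\<^sup>2)) = - (x ^ 3 / (real k / real N)\<^sup>2)"
      using N \<delta> that by (simp add: x3 power_divide field_simps)
    also have "\<dots> \<le> real k / real N / 2 - 7 / 6 * x"
      using x N that by (intro exponent_bound) auto
    finally show ?thesis by (simp add: g_def mult.commute flip: exp_add)
  qed
  have main: "(\<integral>\<omega>. g (X \<omega>) \<partial>\<mu>) \<le> (1 + exp (1 / (2 * real N))) * exp (- (7 / 6 * x))"
  proof (rule expectation_le_discrete[where X = X])
    show "(\<lambda>k. exp (- (7 / 6 * x)) * exp (real (Suc k) / (2 * real N))
        * prob {\<omega> \<in> space \<mu>. X \<omega> = Suc k}) sums ((1 + exp (1 / (2 * real N))) * exp (- (7 / 6 * x)))"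
      using sums_mult[OF exponential_law_moment[OF _ assms(11)], of "exp (- (7 / 6 * x))"] N
      unfolding law by (simp add: mult_ac)
  qed (use g X_pos in \<open>auto simp: g_def intro: prob_space_axioms\<close>)
  also have "\<dots> \<le> c * t powr (- (1 / 6) * (1 + r)) * exp (- x)"
    using N \<delta> t \<nu> assms(14-16) x_def by (rule main_term_bound)
  finally have c_term: "(\<integral>\<omega>. g (X \<omega>) \<partial>\<mu>) \<le> c * t powr (- (1 / 6) * (1 + r)) * exp (- x)" .
  \<comment> \<open>Division by zero gives \<open>1 / real (X \<omega>) = 0\<close> and
    \<open>g (X \<omega>) = 1\<close> where \<open>X \<omega> = 0\<close>, so the bound 1 holds
    everywhere.\<close>
  have int: "integrable \<mu> (\<lambda>\<omega>. 1 / real (X \<omega>))" "integrable \<mu> (\<lambda>\<omega>. g (X \<omega>))"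
    using t by (auto intro!: integrable_const_bound[where B = 1] simp: g_def divide_le_eq)
  have "(\<integral>\<omega>. rrw_return_prob \<delta> E \<omega> t x\<^sub>0 \<partial>\<mu>)
    \<le> (\<integral>\<omega>. 1 / real (X \<omega>) \<partial>\<mu>) + (\<integral>\<omega>. g (X \<omega>) \<partial>\<mu>)"
  proof (cases "integrable \<mu> (\<lambda>\<omega>. rrw_return_prob \<delta> E \<omega> t x\<^sub>0)")
    case True
    have "(\<integral>\<omega>. rrw_return_prob \<delta> E \<omega> t x\<^sub>0 \<partial>\<mu>) \<le> (\<integral>\<omega>. 1 / real (X \<omega>) + g (X \<omega>) \<partial>\<mu>)"
    proof (rule integral_mono_AE[OF True])
      show "AE \<omega> in \<mu>. rrw_return_prob \<delta> E \<omega> t x\<^sub>0 \<le> 1 / real (X \<omega>) + g (X \<omega>)"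
        using X_pos
      proof eventually_elim
        case (elim \<omega>)
        then have "finite (cluster E \<omega> x\<^sub>0)" by (auto simp: X_def intro: card_ge_0_finite)
        then show ?case
          using rrw_return_prob_le[OF assms(1), of \<delta> \<omega> x\<^sub>0 t] \<delta> t by (simp add: X_def g_def)
      qed
    qed (use int in simp)
    then show ?thesis using int by simp
  next
    case False
    \<comment> \<open>the Bochner integral is then \<open>0\<close> by convention\<close>
    then show ?thesis by (simp add: not_integrable_integral_eq g_def)
  qed
  moreover have "0 \<le> sqrt \<rho> * t powr (1 / 4) * exp (- (4 * sqrt t / (real \<delta> * \<rho>)))"
    by (simp add: assms(17))
  ultimately show ?thesis
    using c_term exp_ge_zero[of "- (t / (16 * real N))"] unfolding X_def x_def by linarith
qed

end
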